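(* Let $(X,V,W,S,\mathcal H_*,h,*,\Theta)$ satisfy the abstract symmetrization framework described in the context. Assume that $f:X\to\mathbb R\cup\{+\infty\}$ is a proper, lower semi-continuous, bounded below functional such that $f(u^H)\le f(u)$ for all $u\in S$ and $H\in\mathcal H_*$. Then, for every $u\in S$, $\rho>0$ and $\sigma>0$ there exists an element $v\in X$ such that: (a) $f(w)>f(v)-\sigma\|w-v\|$ for all $w\in X\setminus\{v\}$; (b) $f(v)\le f(u)-\sigma\|v-\mathbb T_\rho u\|$. If in addition $u\in X_{\mathcal H_*}:=\{u\in S: u^H=u\text{ for all }H\in\mathcal H_*\}$, then (b) strengthens into $f(v)\le f(u)-\sigma\|v-u\|$.
   Context: Abstract framework. $X,V,W$ are real Banach spaces with $X\subseteq V\subseteq W$, $X$ continuously embedded in $V$ and $V$ continuously embedded in $W$; $\|\cdot\|$ is the norm of $X$. $S\subseteq X$ carries the metric induced by $\|\cdot\|$, $\mathcal H_*$ is a path-connected topological space, and there are maps $*:S\to S$, $u\mapsto u^*$ (symmetrization) and $h:S\times\mathcal H_*\to S$, $(u,H)\mapsto u^H$ (polarization) such that: $h$ is continuous; $(u^* )^H=(u^H)^*=u^*$ and $(u^H)^H=u^H$ for all $u\in S$, $H\in\mathcal H_*$; there is a sequence $(H_m)\subset\mathcal H_*$ such that for every $u\in S$ the iterated polarizations $u^{H_1\cdots H_m}$ converge to $u^*$ in $V$ as $m\to\infty$; $\|u^H-v^H\|_V\le\|u-v\|_V$ for all $u,v\in S$, $H\in\mathcal H_*$. Moreover $\Theta:(X,\|\cdot\|_V)\to(S,\|\cdot\|_V)$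 is Lipschitz with constant $C_\Theta>0$ and $\Theta|_S=\mathrm{Id}|_S$; for $u\in X$ one sets $u^H:=(\Theta(u))^H$ and $u^*:=(\Theta(u))^*$. For every $\rho>0$, $\mathbb T_\rho:S\to S$ denotes a continuous map such that, for every $u\in S$, $\mathbb T_\rho u$ is obtained from $u$ by finitely many iterated polarizations by elements of $\mathcal H_*$, and $\|\mathbb T_\rho u-u^*\|_V<\rho$ (such maps are known to exist in this framework). Proper means not identically $+\infty$. *)

theory Defs
  imports "HOL-Analysis.Analysis"
begin

text \<open>The iterated polarization \<open>u\<^bsup>H\<^sub>1\<dots>H\<^sub>m\<^esup>\<close> for the list \<open>[H\<^sub>1, \<dots>, H\<^sub>m]\<close>; the element
  \<open>H\<^sub>1\<close> acts first.\<close>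

definition iter_pol :: "('x \<Rightarrow> 'h \<Rightarrow> 'x) \<Rightarrow> 'x \<Rightarrow> 'h list \<Rightarrow> 'x" where
  "iter_pol pol u Hs = foldl pol u Hs"

text \<open>The inclusions \<open>X \<subseteq> V \<subseteq> W\<close> are rendered by injective bounded linear maps \<open>iV\<close> and \<open>iW\<close>
  between Banach space types, so that the \<open>V\<close>-norm of \<open>u \<in> X\<close> is \<open>norm (iV u)\<close>.
  Symmetrization and polarization are total functions on the type of \<open>X\<close>, constrained only
  on \<open>S\<close> and \<open>topspace HT\<close>; \<open>HT\<close> is the topological space \<open>\<H>\<^sub>*\<close>.\<close>

locale symmetrization_framework =
  fixes iV :: "'x::banach \<Rightarrow> 'v::banach"
    and iW :: "'v \<Rightarrow> 'w::banach"
    and S :: "'x set"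
    and HT :: "'h topology"
    and pol :: "'x \<Rightarrow> 'h \<Rightarrow> 'x"
    and star :: "'x \<Rightarrow> 'x"
    and \<Theta> :: "'x \<Rightarrow> 'x"
  assumes iV: "bounded_linear iV" "inj iV"
    and iW: "bounded_linear iW" "inj iW"
    and path_connected_HT: "path_connected_space HT"
    and star_in: "u \<in> S \<Longrightarrow> star u \<in> S"
    and pol_in: "u \<in> S \<Longrightarrow> H \<in> topspace HT \<Longrightarrow> pol u H \<in> S"
    and pol_continuous:
      "continuous_map (prod_topology (top_of_set S) HT) (top_of_set S) (\<lambda>(u, H). pol u H)"
    and pol_star: "u \<in> S \<Longrightarrow> H \<in> topspace HT \<Longrightarrow> pol (star u) H = star u"
    and star_pol: "u \<in> S \<Longrightarrow> H \<in> topspace HT \<Longrightarrow> star (pol u H) = star u"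
    and pol_idem: "u \<in> S \<Longrightarrow> H \<in> topspace HT \<Longrightarrow> pol (pol u H) H = pol u H"
    and approximation:
      "\<exists>Hm. (\<forall>m. Hm m \<in> topspace HT) \<and>
         (\<forall>u\<in>S. (\<lambda>m. iV (iter_pol pol u (map Hm [1..<Suc m]))) \<longlonglongrightarrow> iV (star u))"
    and pol_nonexpansive:
      "u \<in> S \<Longrightarrow> v \<in> S \<Longrightarrow> H \<in> topspace HT \<Longrightarrow>
         norm (iV (pol u H) - iV (pol v H)) \<le> norm (iV u - iV v)"
    and Theta_in: "\<Theta> x \<in> S"
    and Theta_lipschitz:
      "\<exists>C>0. \<forall>x y. norm (iV (\<Theta> x) - iV (\<Theta> y)) \<le> C * norm (iV x - iV y)"
    and Theta_id: "u \<in> S \<Longrightarrow> \<Theta> u = u"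

text \<open>The defining properties of \<open>\<T>\<^sub>\<rho>\<close>; continuity is with respect to the norm of \<open>X\<close>.\<close>

definition is_iterated_polarization_map ::
    "('x::banach \<Rightarrow> 'v::banach) \<Rightarrow> 'x set \<Rightarrow> 'h topology \<Rightarrow> ('x \<Rightarrow> 'h \<Rightarrow> 'x) \<Rightarrow> ('x \<Rightarrow> 'x)
      \<Rightarrow> real \<Rightarrow> ('x \<Rightarrow> 'x) \<Rightarrow> bool" where
  "is_iterated_polarization_map iV S HT pol star \<rho> T \<longleftrightarrow>
     T ` S \<subseteq> S \<and> continuous_on S T \<and>
     (\<forall>u\<in>S. \<exists>Hs. set Hs \<subseteq> topspace HT \<and> T u = iter_pol pol u Hs) \<and>
     (\<forall>u\<in>S. norm (iV (T u) - iV (star u)) < \<rho>)"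

text \<open>The set \<open>X\<^bsub>\<H>\<^sub>*\<^esub>\<close>.\<close>

definition polarization_invariant ::
    "'x set \<Rightarrow> 'h topology \<Rightarrow> ('x \<Rightarrow> 'h \<Rightarrow> 'x) \<Rightarrow> 'x set" where
  "polarization_invariant S HT pol = {u \<in> S. \<forall>H\<in>topspace HT. pol u H = u}"

definition lower_semicontinuous :: "('x::topological_space \<Rightarrow> ereal) \<Rightarrow> bool" where
  "lower_semicontinuous f \<longleftrightarrow> (\<forall>x. \<forall>a < f x. \<forall>\<^sub>F y in nhds x. a < f y)"

end

theory Submission
  imports Defs
begin

text \<open>Polarizations do not increase \<open>f\<close>, so \<open>f (\<bbbT>\<^sub>\<rho> u) \<le> f u\<close>, and Ekeland's variational principle
  started at \<open>\<bbbT>\<^sub>\<rho> u\<close> (at any point of the domain of \<open>f\<close> if \<open>f (\<bbbT>\<^sub>\<rho> u) = \<infinity>\<close>) yields \<open>v\<close>.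
  If \<open>u\<close> is fixed by all polarizations, then \<open>\<bbbT>\<^sub>\<rho> u = u\<close>.\<close>

text \<open>The sets \<open>A x\<close> are the lower sections of the Ekeland order, in which
  \<open>y\<close> precedes \<open>x\<close> when the drop from \<open>F x\<close> to
  \<open>F y\<close> pays for \<open>\<sigma> * dist x y\<close>. Choosing near-minimizers of
  \<open>F\<close> successively in these sections gives nested closed sets with diameters tending to
  0. By completeness they meet in a single point \<open>v\<close>, which is minimal for the
  order.\<close>

theorem ekeland_variational_principle:
  fixes f :: "'a::complete_space \<Rightarrow> ereal"
  assumes lsc: "lower_semicontinuous f"
    and bdd: "\<And>x. ereal m \<le> f x"
    and x0: "f x0 \<noteq> \<infinity>"
    and \<sigma>: "\<sigma> > 0"
  obtains v where "f v \<le> f x0 - ereal (\<sigma> * dist v x0)"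
    and "\<And>w. w \<noteq> v \<Longrightarrow> f w > f v - ereal (\<sigma> * dist w v)"
proof -
  define F where "F = (\<lambda>x. real_of_ereal (f x))"
  define D where "D = {x. f x \<noteq> \<infinity>}"
  define A where "A = (\<lambda>x. {y\<in>D. F y + \<sigma> * dist x y \<le> F x})"
  have f_eq: "f x = ereal (F x)" if "x \<in> D" for x
    using that bdd[of x] unfolding D_def F_def by (cases "f x") auto
  have F_ge: "m \<le> F x" if "x \<in> D" for x
    using bdd[of x] f_eq[OF that] by simp
  have A_D: "A x \<subseteq> D" for x by (auto simp: A_def)
  have A_self: "x \<in> A x" if "x \<in> D" for x using that by (simp add: A_def)
  have A_trans: "A y \<subseteq> A x" if "y \<in> A x" for x y
  proof
    fix z assume "z \<in> A y"
    moreover have "\<sigma> * dist x z \<le> \<sigma> * dist x y + \<sigma> * dist y z"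
      using mult_left_mono[OF dist_triangle[of x z y], of \<sigma>] \<sigma> by (simp add: distrib_left)
    ultimately show "z \<in> A x" using that by (auto simp: A_def)
  qed
  have A_closed: "closed (A x)" if "x \<in> D" for x
  proof -
    \<comment> \<open>Lower semicontinuity enters here: a real \<open>a\<close> strictly between
      \<open>F x - \<sigma> * dist x y\<close> and \<open>f y\<close> still separates the two sides
      near \<open>y\<close>. This also covers \<open>f y = \<infinity>\<close>.\<close>
    have "\<forall>\<^sub>F z in nhds y. z \<notin> A x" if "y \<notin> A x" for y
    proof -
      have "ereal (F x - \<sigma> * dist x y) < f y"
        using that f_eq[of y] by (cases "y \<in> D") (auto simp: A_def D_def)
      then obtain a where a: "F x - \<sigma> * dist x y < a" "ereal a < f y"
        using ereal_dense2[of "ereal (F x - \<sigma> * dist x y)" "f y"] by auto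
      have "((\<lambda>z. F x - \<sigma> * dist x z) \<longlongrightarrow> F x - \<sigma> * dist x y) (nhds y)"
        by (intro tendsto_intros filterlim_ident)
      then have "\<forall>\<^sub>F z in nhds y. F x - \<sigma> * dist x z < a"
        using a(1) by (rule order_tendstoD(2))
      moreover have "\<forall>\<^sub>F z in nhds y. ereal a < f z"
        using lsc a(2) unfolding lower_semicontinuous_def by blast
      ultimately show ?thesis
        by eventually_elim (auto simp: A_def dest: f_eq)
    qed
    then have "open (- A x)"
      by (subst open_subopen) (fastforce simp: eventually_nhds)
    then show ?thesis by (simp add: closed_def)
  qed
  \<comment> \<open>The infimum of \<open>F\<close> over \<open>A x\<close> may not be attained,
    hence the slack, which will tend to 0 along the sequence.\<close>
  have step: "\<exists>y. y \<in> D \<and> y \<in> A x \<and> (\<forall>z\<in>A x. F y \<le> F z + inverse (real (Suc n)))"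
    if "x \<in> D" for x n
  proof -
    have ne: "F ` A x \<noteq> {}" using A_self[OF that] by blast
    have bb: "bdd_below (F ` A x)"
      using F_ge A_D by (intro bdd_belowI2[of _ m]) blast
    have "Inf (F ` A x) < Inf (F ` A x) + inverse (real (Suc n))" by simp
    then obtain y where "y \<in> A x" "F y < Inf (F ` A x) + inverse (real (Suc n))"
      using cInf_lessD[OF ne] by blast
    moreover have "Inf (F ` A x) \<le> F z" if "z \<in> A x" for z
      using cInf_lower[OF _ bb] that by blast
    ultimately show ?thesis using A_D by fastforce
  qed
  have "x0 \<in> D" using x0 by (simp add: D_def)
  then have "\<exists>X. \<forall>n. (X n \<in> D \<and> (n = 0 \<longrightarrow> X n = x0)) \<and>
      (X (Suc n) \<in> A (X n) \<and> (\<forall>z\<in>A (X n). F (X (Suc n)) \<le> F z + inverse (real (Suc n))))"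
    using step by (intro dependent_nat_choice) auto
  then obtain X where X_D: "\<And>n. X n \<in> D" and X_0: "X 0 = x0"
    and X_A: "\<And>n. X (Suc n) \<in> A (X n)"
    and X_min: "\<And>n z. z \<in> A (X n) \<Longrightarrow> F (X (Suc n)) \<le> F z + inverse (real (Suc n))"
    by blast
  have decr: "A (X n) \<subseteq> A (X k)" if "k \<le> n" for k n
    using lift_Suc_antimono_le[of "\<lambda>n. A (X n)", OF A_trans[OF X_A] that] .
  \<comment> \<open>Since \<open>z\<close> also lies in \<open>A (X n)\<close>, near-minimality of
    \<open>X (Suc n)\<close> bounds the drop of \<open>F\<close> from there to \<open>z\<close>, and
    this drop dominates \<open>\<sigma>\<close> times the distance. The index starts at
    \<open>Suc n\<close> because \<open>X 0 = x0\<close> is not chosen as a near-minimizer.\<close>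
  have radius: "\<sigma> * dist (X (Suc n)) z \<le> inverse (real (Suc n))" if "z \<in> A (X (Suc n))" for n z
  proof -
    have "z \<in> A (X n)" using that decr[of n "Suc n"] by auto
    then show ?thesis using X_min[of z n] that by (auto simp: A_def)
  qed
  have small: "\<exists>n. \<forall>y\<in>A (X n). \<forall>z\<in>A (X n). dist y z < e" if "e > 0" for e
  proof -
    \<comment> \<open>The half is there because two points of a section are compared through its
      base point, at the cost of two radii.\<close>
    have "\<sigma> * e / 2 > 0" using \<sigma> that by simp
    then obtain n where n: "inverse (real (Suc n)) < \<sigma> * e / 2"
      using reals_Archimedean by blast
    have "dist y z < e" if "y \<in> A (X (Suc n))" "z \<in> A (X (Suc n))" for y z
    proof -
      have "\<sigma> * dist y z \<le> \<sigma> * (dist (X (Suc n)) y + dist (X (Suc n)) z)"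
        using \<sigma> by (intro mult_left_mono dist_triangle3) auto
      also have "\<dots> < \<sigma> * e"
        using radius[OF that(1)] radius[OF that(2)] n by (simp add: distrib_left)
      finally show ?thesis using \<sigma> by simp
    qed
    then show ?thesis by blast
  qed
  have "\<exists>v. \<Inter>(range (\<lambda>n. A (X n))) = {v}"
  proof (rule decreasing_closed_nest_sing)
    show "closed (A (X n))" for n by (rule A_closed[OF X_D])
    show "A (X n) \<noteq> {}" for n using A_self[OF X_D] by blast
    show "A (X n) \<subseteq> A (X k)" if "k \<le> n" for k n by (rule decr[OF that])
    show "\<exists>n. \<forall>y\<in>A (X n). \<forall>z\<in>A (X n). dist y z < e" if "e > 0" for e
      by (rule small[OF that])
  qed
  then obtain v where v: "(\<Inter>n. A (X n)) = {v}" by blast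
  then have v_A: "v \<in> A (X n)" for n by blast
  then have v_D: "v \<in> D" using A_D by blast
  \<comment> \<open>By transitivity \<open>A v\<close> lies in every \<open>A (X n)\<close>, hence
    in their intersection. This minimality gives the strict inequality for \<open>w\<close> in
    \<open>D\<close>; membership of \<open>v\<close> in \<open>A (X 0)\<close> gives the estimate at
    \<open>x0\<close>.\<close>
  have v_only: "A v \<subseteq> {v}" using A_trans[OF v_A] v by blast
  show thesis
  proof (rule that)
    show "f v \<le> f x0 - ereal (\<sigma> * dist v x0)"
      using v_A[of 0] f_eq[OF v_D] f_eq[OF \<open>x0 \<in> D\<close>] by (simp add: X_0 A_def dist_commute)
    show "f w > f v - ereal (\<sigma> * dist w v)" if "w \<noteq> v" for w
    proof (cases "w \<in> D")
      case True
      then have "\<not> F w + \<sigma> * dist v w \<le> F v" using v_only that by (auto simp: A_def)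
      then show ?thesis using f_eq[OF v_D] f_eq[OF True] by (simp add: dist_commute)
    next
      case False
      then show ?thesis using f_eq[OF v_D] by (simp add: D_def)
    qed
  qed
qed

text \<open>Invariance of \<open>S\<close> keeps every intermediate point where the one-step
  inequality applies, so the inequalities chain. The induction generalizes \<open>u\<close> because
  the head of the list acts first.\<close>

lemma iter_pol_le:
  fixes f :: "'x \<Rightarrow> 'b::preorder"
  assumes "\<And>u H. u \<in> S \<Longrightarrow> H \<in> \<H> \<Longrightarrow> pol u H \<in> S"
    and "\<And>u H. u \<in> S \<Longrightarrow> H \<in> \<H> \<Longrightarrow> f (pol u H) \<le> f u"
    and "u \<in> S" "set Hs \<subseteq> \<H>"
  shows "f (iter_pol pol u Hs) \<le> f u"
  using assms(3,4) unfolding iter_pol_def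
proof (induction Hs arbitrary: u)
  case (Cons H Hs)
  then have "f (foldl pol (pol u H) Hs) \<le> f (pol u H)" using assms(1) by simp
  also have "\<dots> \<le> f u" using Cons.prems assms(2) by simp
  finally show ?case by simp
qed simp

lemma iter_pol_fixed:
  assumes "\<And>H. H \<in> set Hs \<Longrightarrow> pol u H = u"
  shows "iter_pol pol u Hs = u"
  using assms unfolding iter_pol_def by (induction Hs) auto

theorem theorem2p13:
  fixes iV :: "'x::banach \<Rightarrow> 'v::banach"
    and iW :: "'v \<Rightarrow> 'w::banach"
    and S :: "'x set"
    and HT :: "'h topology"
    and pol :: "'x \<Rightarrow> 'h \<Rightarrow> 'x"
    and star :: "'x \<Rightarrow> 'x"
    and \<Theta> :: "'x \<Rightarrow> 'x"
    and T :: "real \<Rightarrow> 'x \<Rightarrow> 'x"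
    and f :: "'x \<Rightarrow> ereal"
  assumes framework: "symmetrization_framework iV iW S HT pol star \<Theta>"
    and T: "\<And>\<rho>. \<rho> > 0 \<Longrightarrow> is_iterated_polarization_map iV S HT pol star \<rho> (T \<rho>)"
    and no_minus_infinity: "\<And>x. f x \<noteq> - \<infinity>"
    and proper: "\<exists>x. f x \<noteq> \<infinity>"
    and lsc: "lower_semicontinuous f"
    and bounded_below: "\<exists>m::real. \<forall>x. ereal m \<le> f x"
    and pol_le: "\<And>u H. u \<in> S \<Longrightarrow> H \<in> topspace HT \<Longrightarrow> f (pol u H) \<le> f u"
  shows "\<forall>u\<in>S. \<forall>\<rho>>0. \<forall>\<sigma>>0. \<exists>v.
      (\<forall>w. w \<noteq> v \<longrightarrow> f w > f v - ereal (\<sigma> * norm (w - v))) \<and>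
      f v \<le> f u - ereal (\<sigma> * norm (v - T \<rho> u)) \<and>
      (u \<in> polarization_invariant S HT pol \<longrightarrow> f v \<le> f u - ereal (\<sigma> * norm (v - u)))"
proof (intro ballI allI impI)
  fix u and \<rho> \<sigma> :: real
  assume u: "u \<in> S" and \<rho>: "\<rho> > 0" and \<sigma>: "\<sigma> > 0"
  interpret symmetrization_framework iV iW S HT pol star \<Theta> by (rule framework)
  obtain Hs where Hs: "set Hs \<subseteq> topspace HT" and Tu: "T \<rho> u = iter_pol pol u Hs"
    using T[OF \<rho>] u unfolding is_iterated_polarization_map_def by blast
  have T_le: "f (T \<rho> u) \<le> f u"
    unfolding Tu using iter_pol_le[of S "topspace HT" pol f] pol_in pol_le u Hs by blast
  have T_fixed: "T \<rho> u = u" if "u \<in> polarization_invariant S HT pol"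
    unfolding Tu using that Hs by (intro iter_pol_fixed) (auto simp: polarization_invariant_def)
  obtain m where m: "\<And>x. ereal m \<le> f x" using bounded_below by blast
  \<comment> \<open>The conditional equation lets one application of Ekeland's principle serve both
    cases.\<close>
  obtain x0 where x0: "f x0 \<noteq> \<infinity>" and x0_T: "f (T \<rho> u) \<noteq> \<infinity> \<Longrightarrow> x0 = T \<rho> u"
    using proper by metis
  obtain v where v_le: "f v \<le> f x0 - ereal (\<sigma> * dist v x0)"
    and v_min: "\<And>w. w \<noteq> v \<Longrightarrow> f w > f v - ereal (\<sigma> * dist w v)"
    using ekeland_variational_principle[OF lsc m x0 \<sigma>] by blast
  have b: "f v \<le> f u - ereal (\<sigma> * norm (v - T \<rho> u))"
  proof (cases "f (T \<rho> u) = \<infinity>")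
    \<comment> \<open>Here \<open>T_le\<close> forces \<open>f u = \<infinity>\<close>, so the
      right-hand side of the bound is infinite.\<close>
    case True
    then show ?thesis using T_le by simp
  next
    case False
    have "f v \<le> f (T \<rho> u) - ereal (\<sigma> * norm (v - T \<rho> u))"
      using v_le x0_T[OF False] by (simp add: dist_norm)
    also have "\<dots> \<le> f u - ereal (\<sigma> * norm (v - T \<rho> u))"
      using T_le by (rule ereal_minus_mono) simp
    finally show ?thesis .
  qed
  show "\<exists>v. (\<forall>w. w \<noteq> v \<longrightarrow> f w > f v - ereal (\<sigma> * norm (w - v))) \<and>
      f v \<le> f u - ereal (\<sigma> * norm (v - T \<rho> u)) \<and>
      (u \<in> polarization_invariant S HT pol \<longrightarrow> f v \<le> f u - ereal (\<sigma> * norm (v - u)))"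
    using v_min b T_fixed by (intro exI[of _ v]) (auto simp: dist_norm)
qed

end
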